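(* Every graph in $\varepsilon_{03}$ has a node of degree $2$.
   Context: All graphs are finite, simple and connected. An Euler graph is a connected graph all of whose nodes have even degree. A cycle of length $n$ is of type $i$ if $n\equiv i\pmod 4$. $\varepsilon_{03}$ is the class of Euler graphs in which every cycle has length $\equiv 0$ or $\equiv 3\pmod 4$ and which contain at least one cycle of each of the types $0$ and $3$. *)

theory Defs
  imports "Graph_Theory.Graph_Theory" "HOL-Number_Theory.Cong"
begin

text \<open>
  A finite simple graph is a \<^locale>\<open>graph\<close>: a finite, loop-free digraph without parallel arcs
  whose arc relation is symmetric, so that an undirected edge is a pair of opposite arcs.
  The degree of a node is therefore its out-degree.

  The library's \<^const>\<open>pre_digraph.cycle\<close> also accepts \<open>u, v, u\<close>, i.e. a single undirected edge
  traversed back and forth; the length bound excludes exactly these.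
\<close>

definition ugraph_cycle :: "('a, 'b) pre_digraph \<Rightarrow> 'b awalk \<Rightarrow> bool" where
  "ugraph_cycle G p \<longleftrightarrow> pre_digraph.cycle G p \<and> 3 \<le> length p"

definition cycle_of_type :: "('a, 'b) pre_digraph \<Rightarrow> nat \<Rightarrow> 'b awalk \<Rightarrow> bool" where
  "cycle_of_type G i p \<longleftrightarrow> ugraph_cycle G p \<and> [length p = i] (mod 4)"

definition euler_graph :: "('a, 'b) pre_digraph \<Rightarrow> bool" where
  "euler_graph G \<longleftrightarrow>
     graph G \<and> Digraph_Component.connected G \<and> (\<forall>v \<in> verts G. even (out_degree G v))"

definition epsilon03 :: "('a, 'b) pre_digraph set" where
  "epsilon03 = {G. euler_graph G
     \<and> (\<forall>p. ugraph_cycle G p \<longrightarrow> cycle_of_type G 0 p \<or> cycle_of_type G 3 p)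
     \<and> (\<exists>p. cycle_of_type G 0 p)
     \<and> (\<exists>p. cycle_of_type G 3 p)}"

end

theory Submission
  imports Defs
begin

text \<open>
  Suppose that no node has degree 2. Then the first node \<open>u\<close> of a longest path has degree at least 4,
  and by maximality all its neighbours lie on the path. Two neighbours at positions \<open>i < j\<close> close the
  segment between them to a cycle of length \<open>j - i + 2\<close> through \<open>u\<close>, so \<open>j - i\<close> is 1 or 2 modulo 4.
  Four positions cannot have all their differences in these two classes: among any three of them
  both consecutive differences must be 1, and then the outer difference of the four is 3.
\<close>

lemma four_nats_difference_mod_4:
  fixes I :: "nat set"
  assumes "4 \<le> card I"
  obtains i j where "i \<in> I" "j \<in> I" "i < j" "(j - i) mod 4 \<noteq> 1" "(j - i) mod 4 \<noteq> 2"
proof -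
  have fin: "finite I"
    using assms card.infinite by fastforce
  obtain a b c d xs where xs: "sorted_list_of_set I = a # b # c # d # xs"
    using assms by (auto simp: numeral_eq_Suc Suc_le_length_iff simp flip: length_sorted_list_of_set)
  have mem: "{a, b, c, d} \<subseteq> I"
    using arg_cong[OF xs, of set] fin by auto
  have less: "a < b" "b < c" "c < d"
    using strict_sorted_list_of_set[of I] unfolding xs by auto
  have "\<exists>i\<in>I. \<exists>j\<in>I. i < j \<and> (j - i) mod 4 \<noteq> 1 \<and> (j - i) mod 4 \<noteq> 2"
  proof (rule ccontr)
    assume "\<not> ?thesis"
    then have diff: "(j - i) mod 4 = 1 \<or> (j - i) mod 4 = 2" if "i \<in> I" "j \<in> I" "i < j" for i j
      using that by blast
    \<comment> \<open>The other sums of two residues from {1, 2} are 3 and 4, which lie in the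
      classes 3 and 0.\<close>
    have both_1: "m = 1 \<and> n = 1"
      if "m = 1 \<or> m = 2" "n = 1 \<or> n = 2" "(m + n) mod 4 = 1 \<or> (m + n) mod 4 = 2" for m n :: nat
      using that by auto
    have consecutive: "(j - i) mod 4 = 1 \<and> (k - j) mod 4 = 1"
      if "i \<in> I" "j \<in> I" "k \<in> I" "i < j" "j < k" for i j k
    proof (rule both_1)
      have "((j - i) mod 4 + (k - j) mod 4) mod 4 = (k - i) mod 4"
        using that(4,5) by (simp add: mod_add_eq)
      then show "((j - i) mod 4 + (k - j) mod 4) mod 4 = 1 \<or> ((j - i) mod 4 + (k - j) mod 4) mod 4 = 2"
        using diff[OF that(1,3) less_trans[OF that(4,5)]] by (simp only:)
    qed (rule diff; fact that)+
    have "(b - a) mod 4 = 1" "(c - b) mod 4 = 1" "(d - c) mod 4 = 1"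
      using consecutive[of a b c] consecutive[of b c d] mem less by auto
    moreover have "(d - a) mod 4 = (((b - a) mod 4 + (c - b) mod 4) mod 4 + (d - c) mod 4) mod 4"
      using less by (simp add: mod_add_eq)
    ultimately have "(d - a) mod 4 = 3"
      by simp
    then show False
      using diff[of a d] mem less by auto
  qed
  then show thesis
    using that by blast
qed

context wf_digraph
begin

text \<open>After its first entry the node list of the closed walk is that of \<open>q\<close>
  followed by \<open>u\<close>, so distinctness amounts to \<open>q\<close> being a path that avoids
  \<open>u\<close>. The list \<open>q\<close> may be empty; a bound on the length is left to the
  caller.\<close>

lemma cycle_closing_apath:
  assumes "apath x q y" "u \<notin> set (awalk_verts x q)"
    and "e \<in> arcs G" "tail G e = u" "head G e = x"
    and "f \<in> arcs G" "tail G f = y" "head G f = u"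
  shows "cycle (e # q @ [f])"
proof -
  have q: "awalk x q y" "distinct (awalk_verts x q)"
    using assms(1) by (auto simp: apath_def)
  have f: "awalk y [f] u"
    using assms(6-8) by (auto simp: awalk_simps)
  have "awalk x (q @ [f]) u"
    using q(1) f by (rule awalk_appendI)
  moreover from this have "awalk_verts x (q @ [f]) = awalk_verts x q @ [u]"
    using assms(8) by (simp add: awalk_verts_append del: awalk_append_iff)
  ultimately show ?thesis
    unfolding cycle_def using assms q
    by (intro exI[of _ u]) (simp add: awalk_Cons_iff del: awalk_append_iff)
qed

text \<open>Supplies the \<open>q\<close> of \<open>cycle_closing_apath\<close>. The node list is
  given explicitly so that avoidance of \<open>u\<close> can be read off from positions;
  \<open>Suc\<close> appears because a path has one node more than arcs.\<close>

lemma apath_segment: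
  assumes "apath u p v" "i \<le> j" "j \<le> length p"
  shows "apath (awalk_verts u p ! i) (take (j - i) (drop i p)) (awalk_verts u p ! j)"
    and "awalk_verts (awalk_verts u p ! i) (take (j - i) (drop i p))
      = take (Suc (j - i)) (drop i (awalk_verts u p))"
proof -
  let ?w = "awalk_verts u p"
  have p: "awalk u p v" "cas u p v" "distinct ?w"
    using assms(1) by (auto simp: apath_def)
  have len: "length ?w = Suc (length p)"
    by (rule length_awalk_verts)
  have last_take: "awlast u (take n p) = ?w ! n" if "n \<le> length p" for n
    using that by (simp add: awalk_verts_take_conv[OF p(2)] take_Suc_conv_app_nth len)
  \<comment> \<open>Cutting the walk at \<open>i\<close> makes the suffix start where the prefix
    ends, at node \<open>?w ! i\<close>.\<close>
  have "awalk u (take i p @ drop i p) v"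
    using p(1) by simp
  then have drop: "awalk (?w ! i) (drop i p) v"
    unfolding awalk_append_iff using last_take assms by simp
  then have cas_drop: "cas (?w ! i) (drop i p) v"
    by blast
  have verts_drop: "awalk_verts (?w ! i) (drop i p) = drop i ?w"
  \<comment> \<open>At \<open>i = length p\<close> no arc remains, and the node list of the empty
    walk is its start node alone, which has to be matched with the last entry of
    \<open>?w\<close>.\<close>
  proof (cases "i < length p")
    case True
    then show ?thesis by (simp add: awalk_verts_drop_conv[OF p(2)])
  next
    case False
    then have "i = length p" using assms by simp
    then show ?thesis
      using len by (simp add: Cons_nth_drop_Suc[symmetric])
  qed
  show verts: "awalk_verts (?w ! i) (take (j - i) (drop i p)) = take (Suc (j - i)) (drop i ?w)"
    by (simp add: awalk_verts_take_conv[OF cas_drop] verts_drop)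
  have "awlast (?w ! i) (take (j - i) (drop i p)) = ?w ! j"
    unfolding verts using assms len by (simp add: take_Suc_conv_app_nth)
  moreover have "awalk (?w ! i) (take (j - i) (drop i p) @ drop (j - i) (drop i p)) v"
    unfolding append_take_drop_id by (rule drop)
  ultimately show "apath (?w ! i) (take (j - i) (drop i p)) (?w ! j)"
    using p(3) unfolding apath_def awalk_append_iff verts by simp
qed

end

text \<open>Path lengths are bounded by the number of nodes, so a greatest one exists. Comparison
  with \<open>p0\<close> lets the caller ensure that the longest path has an arc.\<close>

lemma (in fin_digraph) longest_apath_exists:
  assumes "apath u0 p0 v0"
  obtains u p v where "apath u p v" "length p0 \<le> length p"
    "\<And>u' p' v'. apath u' p' v' \<Longrightarrow> length p' \<le> length p"
proof -
  let ?P = "\<lambda>n. \<exists>u p v. apath u p v \<and> length p = n"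
  have "?P (length p0)"
    using assms by blast
  moreover have "n \<le> card (verts G)" if "?P n" for n
    using that length_apath by blast
  ultimately obtain m where m: "?P m" "\<And>n. ?P n \<Longrightarrow> n \<le> m"
    using Nat.ex_has_greatest_nat[of ?P "length p0" "card (verts G)"] by blast
  then show thesis
    using that assms by blast
qed

context graph
begin

lemma reverse_arc:
  assumes "e \<in> arcs G"
  obtains f where "f \<in> arcs G" "tail G f = head G e" "head G f = tail G e"
  using sym_arcs assms unfolding symmetric_conv by metis

text \<open>Otherwise the reverse of \<open>e\<close> could be put in front of \<open>p\<close>,
  giving a longer path.\<close>

lemma longest_apath_neighbour_on_path:
  assumes "apath u p v" "\<And>u' p' v'. apath u' p' v' \<Longrightarrow> length p' \<le> length p"
    and "e \<in> out_arcs G u"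
  shows "head G e \<in> set (awalk_verts u p)"
proof (rule ccontr)
  assume "head G e \<notin> set (awalk_verts u p)"
  moreover obtain f where "f \<in> arcs G" "tail G f = head G e" "head G f = u"
    using assms(3) by (auto elim: reverse_arc)
  ultimately have "apath (head G e) (f # p) v"
    using assms(1) by (simp add: apath_Cons_iff)
  then show False
    using assms(2) by fastforce
qed

text \<open>Without parallel arcs the out-degree counts distinct neighbours.\<close>

lemma inj_on_head_out_arcs: "inj_on (head G) (out_arcs G u)"
  by (auto intro!: inj_onI no_multi_arcs simp: arc_to_ends_def)

text \<open>Being even and different from 2 leaves degree 0 open, hence the form of the degree
  hypothesis. An arc makes the longest path nonempty, so its first node has positive degree.\<close>

lemma out_degree_ge_4_imp_cycle:
  assumes deg: "\<And>v. v \<in> verts G \<Longrightarrow> out_degree G v \<noteq> 0 \<Longrightarrow> 4 \<le> out_degree G v"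
    and "arcs G \<noteq> {}"
  obtains c where "cycle c" "3 \<le> length c" "length c mod 4 \<noteq> 0" "length c mod 4 \<noteq> 3"
proof -
  obtain a where a: "a \<in> arcs G"
    using assms(2) by blast
  then have "apath (tail G a) [a] (head G a)"
    using no_loops by (auto simp: apath_simps)
  then obtain u p v where p: "apath u p v" "length [a] \<le> length p"
    and longest: "\<And>u' p' v'. apath u' p' v' \<Longrightarrow> length p' \<le> length p"
    by (rule longest_apath_exists) blast
  define w where "w = awalk_verts u p"
  define I where "I = {i. i < length w \<and> w ! i \<in> head G ` out_arcs G u}"
  have w: "distinct w" "w \<noteq> []" "hd w = u" "length w = Suc (length p)"
    using p by (auto simp: w_def apath_def length_awalk_verts)
  have "p \<noteq> []" using p(2) by auto
  then have "hd p \<in> out_arcs G u"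
    using p(1) by (cases p) (auto simp: apath_Cons_iff)
  then have "out_degree G u \<noteq> 0"
    by (auto simp: out_degree_def card_eq_0_iff)
  moreover have "u \<in> verts G"
    using p(1) by (auto simp: apath_def)
  ultimately have "4 \<le> out_degree G u"
    using deg by blast
  also have "out_degree G u = card (head G ` out_arcs G u)"
    by (simp add: out_degree_def card_image inj_on_head_out_arcs)
  also have "head G ` out_arcs G u \<subseteq> (!) w ` I"
  proof
    fix x assume x: "x \<in> head G ` out_arcs G u"
    then obtain e where e: "e \<in> out_arcs G u" "x = head G e"
      by blast
    have "x \<in> set w"
      unfolding w_def e(2) using p(1) longest e(1) by (rule longest_apath_neighbour_on_path)
    then show "x \<in> (!) w ` I"
      using x unfolding I_def in_set_conv_nth by blast
  qed
  then have "card (head G ` out_arcs G u) \<le> card I"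
    by (intro surj_card_le) (auto simp: I_def)
  finally obtain i j where ij: "i \<in> I" "j \<in> I" "i < j"
    and mod: "(j - i) mod 4 \<noteq> 1" "(j - i) mod 4 \<noteq> 2"
    by (rule four_nats_difference_mod_4)
  let ?q = "take (j - i) (drop i p)"
  obtain e where e: "e \<in> arcs G" "tail G e = u" "head G e = w ! i"
    using ij(1) by (auto simp: I_def)
  obtain e' where e': "e' \<in> arcs G" "tail G e' = u" "head G e' = w ! j"
    using ij(2) by (auto simp: I_def)
  obtain f where f: "f \<in> arcs G" "tail G f = w ! j" "head G f = u"
    using reverse_arc[OF e'(1)] e'(2,3) by metis
  \<comment> \<open>Position 0 holds \<open>u\<close>, which is not its own neighbour; hence the
    segment starting at \<open>i\<close> avoids \<open>u\<close>.\<close>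
  have "i \<noteq> 0"
    using e no_loops w by (metis hd_conv_nth)
  have j: "j \<le> length p"
    using ij(2) w by (simp add: I_def)
  have "w = u # tl w"
    using w by (metis list.collapse)
  then have "u \<notin> set (drop i w)"
    using w(1) \<open>i \<noteq> 0\<close> by (metis distinct.simps(2) drop_Cons' in_set_dropD)
  then have "u \<notin> set (awalk_verts (w ! i) ?q)"
    using apath_segment(2)[OF p(1) _ j, of i] ij(3) by (auto simp: w_def dest: in_set_takeD)
  moreover have "apath (w ! i) ?q (w ! j)"
    using apath_segment(1)[OF p(1) _ j, of i] ij(3) by (simp add: w_def)
  ultimately have "cycle (e # ?q @ [f])"
    using e f by (intro cycle_closing_apath) auto
  \<comment> \<open>The arcs \<open>e\<close> and \<open>f\<close> add 2, which moves the excluded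
    residues 1 and 2 of \<open>j - i\<close> to 3 and 0. Since \<open>i < j\<close>, the cycle is
    not a single edge traversed back and forth.\<close>
  moreover have "length (e # ?q @ [f]) = j - i + 2"
    using ij(3) j by simp
  moreover have "3 \<le> j - i + 2"
    using ij(3) by simp
  moreover have "(j - i + 2) mod 4 \<noteq> 0 \<and> (j - i + 2) mod 4 \<noteq> 3"
    using mod by (simp only: mod_Suc add_2_eq_Suc') (auto split: if_splits)
  ultimately show thesis
    using that by metis
qed

end

theorem theorem11:
  fixes G :: "('a, 'b) pre_digraph"
  assumes "G \<in> epsilon03"
  shows "\<exists>v \<in> verts G. out_degree G v = 2"
proof (rule ccontr)
  assume no_deg_2: "\<not> ?thesis"
  have euler: "euler_graph G"
    and types: "\<And>p. ugraph_cycle G p \<Longrightarrow> cycle_of_type G 0 p \<or> cycle_of_type G 3 p"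
    and ex: "\<exists>p. cycle_of_type G 0 p"
    using assms by (auto simp: epsilon03_def)
  interpret graph G
    using euler by (simp add: euler_graph_def)
  have "4 \<le> out_degree G v" if "v \<in> verts G" "out_degree G v \<noteq> 0" for v
  proof -
    have "even (out_degree G v)" "out_degree G v \<noteq> 2"
      using that no_deg_2 euler by (auto simp: euler_graph_def)
    with that(2) show ?thesis by presburger
  qed
  \<comment> \<open>A cycle is a nonempty walk, so the one of type 0 exhibits an arc.\<close>
  moreover have "arcs G \<noteq> {}"
    using ex by (auto simp: cycle_of_type_def ugraph_cycle_def cycle_def awalk_def)
  ultimately obtain c where c: "cycle c" "3 \<le> length c" "length c mod 4 \<noteq> 0" "length c mod 4 \<noteq> 3"
    by (rule out_degree_ge_4_imp_cycle)
  then show False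
    using types[of c] by (auto simp: cycle_of_type_def ugraph_cycle_def cong_def)
qed

end
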